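(* For any closed convex curve $\Gamma$ in the Euclidean plane, one has $$L(\Gamma)\leq (2+\pi)\cdot\delta(\Gamma),$$ with equality exactly for boundaries of half-disks.
   Context: The Euclidean plane is identified with $\mathbb{R}^2$ with the standard Euclidean metric $d$. A convex curve is the boundary of some convex compact set in $\mathbb{R}^2$. $L(\Gamma)$ denotes the length (perimeter) of $\Gamma$; the perimeter of a line segment (regarded as a convex polygon with 2 vertices) is defined as twice the length of the segment. The relative Chebyshev radius of $\Gamma$ (with respect to $\Gamma$ itself) is $$\delta(\Gamma)=\inf_{p\in\Gamma}\,\sup_{q\in\Gamma} d(p,q).$$ A half-disk is a set in $\mathbb{R}^2$ isometric to $HD(r)=\{(x_1,x_2)\in\mathbb{R}^2 : x_2\geq 0,\ x_1^2+x_2^2\leq r^2\}$ for some fixed $r>0$; the boundary of $HD(r)$ is the union of a half-circle of radius $r$ and a line segment of length $2r$.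
   Formalization: The equality characterization is stated only for convex curves that are not a single point: a one-point curve has length and relative Chebyshev radius 0, so equality holds there although it is not the boundary of a half-disk. *)

theory Defs
  imports "HOL-Analysis.Analysis"
begin

definition convex_curve :: "(real^2) set \<Rightarrow> bool" where
  "convex_curve \<Gamma> \<longleftrightarrow> (\<exists>K. convex K \<and> compact K \<and> K \<noteq> {} \<and> \<Gamma> = frontier K)"

(* Supremum of the lengths of inscribed polygonal lines; \<open>ennreal\<close> because a path
   need not be rectifiable. *)
definition path_length :: "(real \<Rightarrow> 'a::metric_space) \<Rightarrow> ennreal" where
  "path_length g =
     (SUP ts \<in> {ts. sorted ts \<and> set ts \<subseteq> {0..1}}.
        \<Sum>i<length ts - 1. ennreal (dist (g (ts ! i)) (g (ts ! Suc i))))"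

(* A convex set with empty interior is its own frontier, so the curve is then a segment,
   traversed back and forth: it counts twice (a point has perimeter 0).  Otherwise the
   curve is a simple closed curve, whose arc length does not depend on the simple closed
   parametrization. *)
definition perimeter :: "(real^2) set \<Rightarrow> ennreal" where
  "perimeter \<Gamma> =
     (if \<exists>a b. \<Gamma> = closed_segment a b
      then (THE l. \<exists>a b. \<Gamma> = closed_segment a b \<and> l = ennreal (2 * dist a b))
      else (THE l. \<exists>g. simple_path g \<and> pathfinish g = pathstart g \<and>
                       path_image g = \<Gamma> \<and> l = path_length g))"

definition rel_chebyshev_radius :: "'a::metric_space set \<Rightarrow> real" where
  "rel_chebyshev_radius \<Gamma> = (INF p\<in>\<Gamma>. SUP q\<in>\<Gamma>. dist p q)"

definition HD :: "real \<Rightarrow> (real^2) set" where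
  "HD r = {x. x $ 2 \<ge> 0 \<and> (x $ 1)\<^sup>2 + (x $ 2)\<^sup>2 \<le> r\<^sup>2}"

definition isometric_sets :: "'a::metric_space set \<Rightarrow> 'b::metric_space set \<Rightarrow> bool" where
  "isometric_sets A B \<longleftrightarrow>
     (\<exists>f. f ` A = B \<and> (\<forall>x\<in>A. \<forall>y\<in>A. dist (f x) (f y) = dist x y))"

definition half_disk :: "(real^2) set \<Rightarrow> bool" where
  "half_disk H \<longleftrightarrow> (\<exists>r>0. isometric_sets (HD r) H)"

end

theory Submission
  imports Defs
begin

text \<open>
  Let \<open>K\<close> be a convex body in the plane with frontier \<open>\<Gamma>\<close>, and let \<open>p\<close> be a point of \<open>\<Gamma>\<close> that
  realizes the relative Chebyshev radius \<open>\<delta>\<close>. All of \<open>\<Gamma>\<close>, hence all of \<open>K\<close>, lies in the disk of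
  radius \<open>\<delta>\<close> about \<open>p\<close>, and since \<open>p\<close> lies on the frontier, a supporting line at \<open>p\<close> confines
  \<open>K\<close> to a half-disk of that disk (\<open>subset_half_disk_at\<close>). The perimeter of a convex body strictly
  increases with the body, and the perimeter of the half-disk is \<open>(2 + \<pi>) \<delta>\<close>. This gives the
  inequality, and shows that equality forces \<open>K\<close> to be the half-disk. Conversely, a half-disk of
  radius \<open>r\<close> has \<open>\<delta> \<le> r\<close>, as one sees from its centre, and \<open>\<delta> \<ge> r\<close> by the inequality applied to
  the half-disk.

  Both properties of the perimeter come from Cauchy's formula: the length of \<open>\<Gamma>\<close> is half the
  integral of the width of \<open>K\<close> over all directions (\<open>path_length_eq_integral_width\<close>). Monotonicity is
  then immediate, strictness follows from separation of points and continuity of the width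
  (\<open>integral_width_strict_mono\<close>), and the width of a half-disk is explicit
  (\<open>width_half_disk_at\<close>).

  For Cauchy's formula, the length of a vector is a quarter of the integral of its projections to
  all directions (\<open>has_integral_abs_inner_dir\<close>). It is therefore enough that, in a fixed direction,
  the variation of the coordinate function along a simple closed parametrization of \<open>\<Gamma>\<close> is twice
  the width. It is not larger, because a line strictly between two supporting lines meets \<open>\<Gamma>\<close> in at
  most two points (\<open>card_line_frontier_le_2\<close>), so each level is taken at most twice
  (\<open>variation_le_if_levels_card_le\<close>). It is not smaller, because the path has to travel between the
  two extreme points and back (\<open>closed_variation_ge\<close>), and this holds up to an error that is uniform
  in the direction for fine inscribed polygons. The formula also shows that the length does not
  depend on the parametrization.

  If \<open>K\<close> has no interior points it is a segment, whose perimeter is at most \<open>4 \<delta>\<close>, and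
  \<open>4 < 2 + \<pi>\<close>.
\<close>

section \<open>Unit vectors of the plane\<close>

definition dir :: "real \<Rightarrow> real^2" where
  "dir t = (\<chi> i. if i = 1 then cos t else sin t)"

lemma dir_component [simp]: "dir t $ 1 = cos t" "dir t $ 2 = sin t"
  by (simp_all add: dir_def)

lemma inner_real2: "(x::real^2) \<bullet> y = x$1 * y$1 + x$2 * y$2"
  by (simp add: inner_vec_def sum_2)

lemma norm_real2: "(norm (x::real^2))\<^sup>2 = (x$1)\<^sup>2 + (x$2)\<^sup>2"
  unfolding power2_norm_eq_inner by (simp add: inner_real2 power2_eq_square)

lemma norm_dir [simp]: "norm (dir t) = 1"
  by (simp add: norm_eq_sqrt_inner inner_real2 flip: power2_eq_square)

lemma unit_vector_eq_dir:
  fixes v :: "real^2"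
  assumes "norm v = 1"
  obtains t where "0 \<le> t" "t \<le> 2 * pi" "v = dir t"
proof -
  have "(v$1)\<^sup>2 + (v$2)\<^sup>2 = 1" using norm_real2[of v] assms by simp
  then obtain t where "0 \<le> t" "t < 2 * pi" "v$1 = cos t" "v$2 = sin t"
    using sincos_total_2pi by metis
  then show ?thesis by (intro that[of t]) (auto simp: vec_eq_iff forall_2)
qed

lemma continuous_on_dir [continuous_intros]:
  fixes f :: "'a::t2_space \<Rightarrow> real"
  shows "continuous_on S f \<Longrightarrow> continuous_on S (\<lambda>t. dir (f t))"
  unfolding dir_def
proof (rule continuous_on_vec_lambda)
  fix i :: 2
  assume "continuous_on S f"
  then show "continuous_on S (\<lambda>x. if i = 1 then cos (f x) else sin (f x))"
    by (cases "i = 1") (auto intro: continuous_on_cos continuous_on_sin)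
qed

lemma integral_period:
  fixes f :: "real \<Rightarrow> real"
  assumes cont: "continuous_on UNIV f" and per: "\<And>x. f (x + p) = f x" and a: "0 \<le> a" "a \<le> p"
  shows "integral {a..a + p} f = integral {0..p} f"
proof -
  have int: "f integrable_on {c..d}" for c d
    using cont by (intro integrable_continuous_real) (auto intro: continuous_on_subset)
  have "integral {p..a+p} f = integral {0..a} f"
    using integral_shift_Icc_real[of 0 a f p] per by (simp add: o_def add.commute)
  then show ?thesis
    using Henstock_Kurzweil_Integration.integral_combine[OF a int]
      Henstock_Kurzweil_Integration.integral_combine[of a p "a+p", OF _ _ int] a by simp
qed

lemma has_integral_abs_cos: "((\<lambda>t. \<bar>cos t\<bar>) has_integral 4) {0..2*pi}"
proof -
  have 1: "((\<lambda>t. \<bar>cos t\<bar>) has_integral (sin (pi/2) - sin 0)) {0..pi/2}"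
    by (rule has_integral_eq[OF _ fundamental_theorem_of_calculus[of _ _ sin cos]])
       (auto intro!: cos_ge_zero abs_of_nonneg[symmetric] derivative_eq_intros simp flip: has_real_derivative_iff_has_vector_derivative)
  have 2: "((\<lambda>t. \<bar>cos t\<bar>) has_integral ((- sin (3*pi/2)) - (- sin (pi/2)))) {pi/2..3*pi/2}"
  proof (rule has_integral_eq[OF _ fundamental_theorem_of_calculus[of _ _ "\<lambda>t. - sin t" "\<lambda>t. - cos t"]])
    fix x assume "x \<in> {pi/2..3*pi/2}"
    then have "cos (x - pi) \<ge> 0" by (intro cos_ge_zero) auto
    then show "- cos x = \<bar>cos x\<bar>" by (simp add: cos_diff)
  qed (auto intro!: derivative_eq_intros simp flip: has_real_derivative_iff_has_vector_derivative)
  have 3: "((\<lambda>t. \<bar>cos t\<bar>) has_integral (sin (2*pi) - sin (3*pi/2))) {3*pi/2..2*pi}"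
  proof (rule has_integral_eq[OF _ fundamental_theorem_of_calculus[of _ _ sin cos]])
    fix x assume "x \<in> {3*pi/2..2*pi}"
    then have "cos (x - 2*pi) \<ge> 0" by (intro cos_ge_zero) auto
    then show "cos x = \<bar>cos x\<bar>" by (simp add: cos_diff)
  qed (auto intro!: derivative_eq_intros simp flip: has_real_derivative_iff_has_vector_derivative)
  have s: "sin (3*pi/2) = -1" using sin_3over2_pi by (simp add: field_simps)
  show ?thesis
    using has_integral_combine[OF _ _ has_integral_combine[OF _ _ 1 2] 3] by (simp add: s)
qed

text \<open>
  This is what turns lengths into integrals of one-dimensional variations: averaged over all
  directions, the shadow of a vector is a fixed multiple of its length. If \<open>v\<close> has polar angle
  \<open>s\<close>, the integrand is \<open>\<bar>cos (t - s)\<bar>\<close> up to the factor \<open>norm v\<close>, and periodicity removes the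
  shift.
\<close>

lemma has_integral_abs_inner_dir:
  "((\<lambda>t. \<bar>dir t \<bullet> v\<bar>) has_integral 4 * norm v) {0..2*pi}"
proof (cases "v = 0")
  case False
  obtain s where s: "0 \<le> s" "s \<le> 2*pi" "v /\<^sub>R norm v = dir s"
    using unit_vector_eq_dir[of "v /\<^sub>R norm v"] False by auto
  \<comment> \<open>The shift by \<open>- s\<close>, moved by one period into the range covered by \<open>integral_period\<close>.\<close>
  define a where "a = 2*pi - s"
  have v: "v = norm v *\<^sub>R dir s" using s(3) False by (simp flip: s(3))
  have eq: "\<bar>dir t \<bullet> v\<bar> = norm v * \<bar>cos (t + a)\<bar>" for t
  proof -
    have "cos (t + a) = cos (t - s)"
      using cos_periodic[of "t - s"] by (simp add: a_def algebra_simps)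
    then have "dir t \<bullet> v = norm v * cos (t + a)"
      by (subst v) (simp add: inner_real2 cos_diff algebra_simps)
    then show ?thesis by (simp add: abs_mult)
  qed
  have cont: "continuous_on S (\<lambda>t::real. \<bar>cos t\<bar>)" for S by (intro continuous_intros)
  have "integral {a..a+2*pi} (\<lambda>t. \<bar>cos t\<bar>) = 4"
    using integral_period[of "\<lambda>t. \<bar>cos t\<bar>" "2*pi" a] cont s has_integral_abs_cos
    by (auto simp: a_def integral_unique)
  then have "((\<lambda>t. \<bar>cos t\<bar>) has_integral 4) {a..a+2*pi}"
    using cont by (metis integrable_continuous_real integrable_integral)
  then have "((\<lambda>t. \<bar>cos (t + a)\<bar>) has_integral 4) {0..2*pi}"
    using has_integral_shift_real_ivl[of _ 4 a "a+2*pi" a] by simp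
  then show ?thesis unfolding eq using has_integral_mult_right[of _ 4 _ "norm v"] by (metis mult.commute)
qed simp

section \<open>Support function and width\<close>

definition support :: "'a::real_inner set \<Rightarrow> 'a \<Rightarrow> real" where
  "support S v = (SUP x\<in>S. v \<bullet> x)"

definition width :: "'a::real_inner set \<Rightarrow> 'a \<Rightarrow> real" where
  "width S v = support S v + support S (- v)"

lemma support_attained:
  fixes S :: "'a::real_inner set"
  assumes "compact S" "S \<noteq> {}"
  obtains x where "x \<in> S" "support S v = v \<bullet> x" "\<And>y. y \<in> S \<Longrightarrow> v \<bullet> y \<le> v \<bullet> x"
proof -
  have "\<exists>x\<in>S. \<forall>y\<in>S. v \<bullet> y \<le> v \<bullet> x"
    by (rule continuous_attains_sup[OF assms]) (intro continuous_intros)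
  then obtain x where x: "x \<in> S" "\<And>y. y \<in> S \<Longrightarrow> v \<bullet> y \<le> v \<bullet> x" by blast
  moreover have "support S v = v \<bullet> x"
    unfolding support_def by (rule cSup_eq_maximum) (use x in auto)
  ultimately show ?thesis using that by blast
qed

lemma inner_le_support: "compact S \<Longrightarrow> x \<in> S \<Longrightarrow> v \<bullet> x \<le> support S v"
  by (metis support_attained empty_iff)

lemma support_mono:
  assumes "compact S" "S \<noteq> {}" "compact T" "S \<subseteq> T"
  shows "support S v \<le> support T v"
  by (metis assms inner_le_support subset_iff support_attained)

lemma continuous_on_support:
  fixes S :: "'a::real_inner set"
  assumes S: "compact S" "S \<noteq> {}"
  shows "continuous_on A (support S)"
proof -
  obtain B where B: "\<And>x. x \<in> S \<Longrightarrow> norm x \<le> B" "B > 0"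
    using compact_imp_bounded[OF S(1)] bounded_pos by blast
  \<comment> \<open>The support function is Lipschitz with any bound on the norms of the points of \<open>S\<close>.\<close>
  have le: "support S v \<le> support S w + B * norm (v - w)" for v w
  proof -
    obtain x where x: "x \<in> S" "support S v = v \<bullet> x" using support_attained[OF S] by metis
    have "v \<bullet> x = w \<bullet> x + (v - w) \<bullet> x" by (simp add: inner_diff_left)
    also have "(v - w) \<bullet> x \<le> B * norm (v - w)"
      by (metis B(1) mult.commute mult_left_mono norm_cauchy_schwarz norm_ge_zero order_trans x(1))
    also have "w \<bullet> x \<le> support S w" by (rule inner_le_support[OF S(1) x(1)])
    finally show ?thesis using x by simp
  qed
  have "B-lipschitz_on A (support S)"
  proof (rule lipschitz_onI)
    fix v w
    show "dist (support S v) (support S w) \<le> B * dist v w"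
      using le[of v w] le[of w v] by (auto simp: dist_norm norm_minus_commute)
  qed (use B in simp)
  then show ?thesis by (rule lipschitz_on_continuous_on)
qed

lemma continuous_on_width:
  fixes S :: "'a::real_inner set"
  assumes S: "compact S" "S \<noteq> {}"
  shows "continuous_on A (width S)"
  unfolding width_def
  by (intro continuous_on_add continuous_on_support[OF S]
        continuous_on_compose2[OF continuous_on_support[OF S, of UNIV]] continuous_intros) auto

lemma continuous_on_width_dir:
  fixes S :: "(real^2) set"
  assumes S: "compact S" "S \<noteq> {}"
  shows "continuous_on A (\<lambda>t. width S (dir t))"
  by (rule continuous_on_compose2[OF continuous_on_width[OF S, of UNIV]]) (auto intro: continuous_intros)

lemma width_mono:
  assumes "compact S" "S \<noteq> {}" "compact T" "S \<subseteq> T"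
  shows "width S v \<le> width T v"
  using support_mono[OF assms] by (simp add: width_def add_mono)

text \<open>
  A point of \<open>T\<close> outside \<open>S\<close> is strictly separated from \<open>S\<close>, which makes \<open>T\<close> strictly wider in
  the separating direction. By continuity of the width the difference then has a positive integral.
  This is the source of the uniqueness of the extremal curves.
\<close>

lemma integral_width_strict_mono:
  fixes S T :: "(real^2) set"
  assumes S: "compact S" "S \<noteq> {}" "convex S" and T: "compact T" "S \<subset> T"
  shows "integral {0..2*pi} (\<lambda>t. width S (dir t)) < integral {0..2*pi} (\<lambda>t. width T (dir t))"
proof -
  have T': "T \<noteq> {}" "S \<subseteq> T" using T S by auto
  let ?d = "\<lambda>t. width T (dir t) - width S (dir t)"
  obtain z where z: "z \<in> T" "z \<notin> S" using T by auto
  obtain a b where ab: "a \<bullet> z < b" "\<And>x. x \<in> S \<Longrightarrow> a \<bullet> x > b"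
    using separating_hyperplane_closed_point[OF S(3) compact_imp_closed[OF S(1)] z(2)] by blast
  have "a \<noteq> 0" using ab S(2) by force
  define v where "v = - (a /\<^sub>R norm a)"
  have v: "- a = norm a *\<^sub>R v" using \<open>a \<noteq> 0\<close> by (simp add: v_def)
  have sep: "v \<bullet> x < v \<bullet> z" if "x \<in> S" for x
  proof -
    have "(- a) \<bullet> x < (- a) \<bullet> z" using ab that by force
    then show ?thesis unfolding v using \<open>a \<noteq> 0\<close> by simp
  qed
  have "norm v = 1" using \<open>a \<noteq> 0\<close> by (simp add: v_def)
  then obtain t where t: "0 \<le> t" "t \<le> 2 * pi" "v = dir t" by (rule unit_vector_eq_dir)
  have "support S v < support T v"
    using support_attained[OF S(1,2), of v] sep inner_le_support[OF T(1) z(1), of v] by (metis less_le_trans)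
  then have pos: "?d t > 0"
    using support_mono[OF S(1,2) T(1) T'(2), of "- v"] t(3) by (simp add: width_def)
  have cont: "continuous_on A ?d" for A
    by (intro continuous_on_diff continuous_on_width_dir S T T')
  have "integral {0..2*pi} ?d \<noteq> 0"
    using integral_eq_0_iff[of 0 "2*pi" ?d] cont pos t width_mono[OF S(1,2) T(1) T'(2)] by force
  moreover have "integral {0..2*pi} ?d \<ge> 0"
    by (rule integral_nonneg[OF integrable_continuous_real[OF cont]])
       (simp add: width_mono[OF S(1,2) T(1) T'(2)])
  moreover have "integral {0..2*pi} ?d = integral {0..2*pi} (\<lambda>t. width T (dir t)) - integral {0..2*pi} (\<lambda>t. width S (dir t))"
    by (intro integral_diff integrable_continuous_real continuous_on_width_dir S T T')
  ultimately show ?thesis by simp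
qed

section \<open>Variation along a convex curve\<close>

lemma supporting_hyperplane_frontier:
  fixes K :: "'a::euclidean_space set"
  assumes "convex K" "closed K" "interior K \<noteq> {}" "y \<in> frontier K"
  obtains n where "norm n = 1" "\<And>k. k \<in> K \<Longrightarrow> n \<bullet> y \<le> n \<bullet> k"
proof -
  have "y \<in> K" "y \<notin> rel_interior K"
    using assms by (auto simp: frontier_def rel_interior_nonempty_interior)
  then obtain a where a: "a \<noteq> 0" "\<And>k. k \<in> K \<Longrightarrow> a \<bullet> y \<le> a \<bullet> k"
    using supporting_hyperplane_rel_boundary[OF assms(1)] by metis
  show ?thesis
    by (rule that[of "a /\<^sub>R norm a"]) (use a in \<open>auto intro: mult_left_mono\<close>)
qed

text \<open>
  A line of level \<open>c\<close> that separates two points of \<open>K\<close> cannot meet the frontier in three points.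
  The supporting line of \<open>K\<close> at the middle point would contain the outer two, hence be the given
  line; but then \<open>K\<close> would lie on one side of it.
\<close>

lemma not_three_on_line:
  fixes u :: "real^2"
  assumes K: "convex K" "closed K" "interior K \<noteq> {}"
    and a: "a \<in> K" "u \<bullet> a < c" and b: "b \<in> K" "c < u \<bullet> b"
    and fr: "x \<in> frontier K" "y \<in> frontier K" "z \<in> frontier K"
    and lev: "u \<bullet> x = c" "u \<bullet> y = c" "u \<bullet> z = c"
    and bet: "y \<in> open_segment x z"
  shows False
proof -
  obtain n where n: "norm n = 1" "\<And>k. k \<in> K \<Longrightarrow> n \<bullet> y \<le> n \<bullet> k"
    by (rule supporting_hyperplane_frontier[OF K fr(2)]) blast
  have xz: "x \<in> K" "z \<in> K" "x \<noteq> z" using fr K bet by (auto simp: frontier_def)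
  obtain s where s: "0 < s" "s < 1" "y = (1 - s) *\<^sub>R x + s *\<^sub>R z"
    using bet by (auto simp: in_segment)
  have ny: "n \<bullet> y = (1 - s) * (n \<bullet> x) + s * (n \<bullet> z)" by (simp add: s inner_add_right)
  have "(1 - s) * (n \<bullet> x - n \<bullet> y) + s * (n \<bullet> z - n \<bullet> y) = 0"
    using ny by (simp add: algebra_simps)
  moreover have "(1 - s) * (n \<bullet> x - n \<bullet> y) \<ge> 0" "s * (n \<bullet> z - n \<bullet> y) \<ge> 0"
    using n xz s by auto
  ultimately have "s * (n \<bullet> z - n \<bullet> y) = 0" "(1 - s) * (n \<bullet> x - n \<bullet> y) = 0" by linarith+
  then have "n \<bullet> x = n \<bullet> y" "n \<bullet> z = n \<bullet> y" using s by auto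
  define w where "w = x - z"
  have w: "w \<noteq> 0" "n \<bullet> w = 0" "u \<bullet> w = 0"
    using \<open>n \<bullet> x = n \<bullet> y\<close> \<open>n \<bullet> z = n \<bullet> y\<close> lev xz by (auto simp: w_def inner_diff_right)
  have "u \<noteq> 0" using a b by auto
  \<comment> \<open>\<open>n\<close> and \<open>u\<close> are orthogonal to the same nonzero vector of the plane, so they are parallel.\<close>
  define l where "l = (n \<bullet> u) / (u \<bullet> u)"
  have det: "n$1 * u$2 = n$2 * u$1"
  proof -
    have "(n$1 * u$2 - n$2 * u$1) * w$1 = 0" "(n$1 * u$2 - n$2 * u$1) * w$2 = 0"
      using w(2,3) unfolding inner_real2 by algebra+
    then show ?thesis using w(1) by (auto simp: vec_eq_iff forall_2)
  qed
  have nl: "n = l *\<^sub>R u"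
  proof -
    have "(u \<bullet> u) *\<^sub>R n = (n \<bullet> u) *\<^sub>R u"
      using det by (simp add: vec_eq_iff forall_2 inner_real2) algebra
    moreover have "u \<bullet> u \<noteq> 0" using \<open>u \<noteq> 0\<close> by simp
    ultimately show ?thesis unfolding l_def by (metis vector_fraction_eq_iff)
  qed
  have "l * c \<le> l * (u \<bullet> a)" "l * c \<le> l * (u \<bullet> b)" using n(2)[OF a(1)] n(2)[OF b(1)] lev by (simp_all add: nl)
  moreover have "l \<noteq> 0" using n nl by auto
  ultimately show False using a b by (auto simp: mult_le_cancel_left)
qed

lemma card_line_frontier_le_2:
  fixes u :: "real^2"
  assumes K: "convex K" "closed K" "interior K \<noteq> {}"
    and a: "a \<in> K" "u \<bullet> a < c" and b: "b \<in> K" "c < u \<bullet> b"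
    and F: "finite F" "F \<subseteq> frontier K" "\<And>x. x \<in> F \<Longrightarrow> u \<bullet> x = c"
  shows "card F \<le> 2"
proof (rule ccontr)
  assume "\<not> card F \<le> 2"
  then have "3 \<le> card F" by simp
  then obtain G where "G \<subseteq> F" "card G = 3"
    by (rule obtain_subset_with_card_n)
  then obtain x y z where G: "x \<in> F" "y \<in> F" "z \<in> F" "x \<noteq> y" "y \<noteq> z" "x \<noteq> z"
    unfolding card_3_iff by blast
  have "u \<noteq> 0" using a b by auto
  have "collinear {x, y, z}"
  proof -
    have "{x, y, z} \<subseteq> {p. u \<bullet> p = c}" using F G by auto
    then have "aff_dim {x, y, z} \<le> 1"
      using aff_dim_subset[of "{x,y,z}" "{p. u \<bullet> p = c}"] aff_dim_hyperplane[OF \<open>u \<noteq> 0\<close>, of c] by simp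
    then show ?thesis by (simp add: collinear_aff_dim)
  qed
  then have "between (y, z) x \<or> between (z, x) y \<or> between (x, y) z"
    by (simp only: collinear_between_cases)
  then have "x \<in> open_segment y z \<or> y \<in> open_segment z x \<or> z \<in> open_segment x y"
    using G(4-6) by (auto simp: between_mem_segment open_segment_def)
  then show False
    using not_three_on_line[OF K a b] F G by blast
qed

text \<open>
  One half of the Banach indicatrix theorem: the variation of \<open>f\<close> is at most the integral, over all
  levels, of the number of times the level is taken. The increment over one subinterval is the length
  of the interval \<open>I i\<close> of levels strictly between its two end values, and by the intermediate value
  theorem such a level is taken strictly inside the subinterval. So a level lying in several of the
  \<open>I i\<close> is taken at as many distinct points.
\<close>

lemma variation_le_if_levels_card_le:
  fixes f :: "real \<Rightarrow> real"
  assumes f: "continuous_on {0..1} f" "\<And>s. s \<in> {0..1} \<Longrightarrow> m \<le> f s \<and> f s \<le> M"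
    and lev: "\<And>c F. finite F \<Longrightarrow> F \<subseteq> {0<..<1} \<Longrightarrow> m < c \<Longrightarrow> c < M \<Longrightarrow> (\<And>s. s \<in> F \<Longrightarrow> f s = c) \<Longrightarrow> card F \<le> N"
    and ts: "sorted ts" "set ts \<subseteq> {0..1}"
  shows "(\<Sum>i<length ts - 1. \<bar>f (ts ! Suc i) - f (ts ! i)\<bar>) \<le> N * (M - m)"
proof -
  define I where "I i = {min (f (ts ! i)) (f (ts ! Suc i)) <..< max (f (ts ! i)) (f (ts ! Suc i))}" for i
  let ?n = "length ts - 1"
  have "m \<le> M" using f(2)[of 0] by auto
  have tsI: "ts ! i \<in> {0..1}" "ts ! Suc i \<in> {0..1}" if "i < ?n" for i
    by (rule subsetD[OF ts(2) nth_mem], use that in simp)+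
  have mono: "ts ! i \<le> ts ! j" if "i \<le> j" "j \<le> ?n" "i < ?n" for i j
    using ts(1) that by (intro sorted_nth_mono) auto
  have count: "(\<Sum>i<?n. indicat_real (I i) c) \<le> N * indicat_real {m..M} c" for c
  proof -
    define J where "J = {i. i < ?n \<and> c \<in> I i}"
    have "\<exists>s. ts ! i < s \<and> s < ts ! Suc i \<and> f s = c" if i: "i \<in> J" for i
    proof -
      have i': "i < ?n" "c \<in> I i" using i by (auto simp: J_def)
      have cont: "continuous_on {ts ! i..ts ! Suc i} f"
        using tsI[OF i'(1)] by (intro continuous_on_subset[OF f(1)]) auto
      have le: "ts ! i \<le> ts ! Suc i" using mono[of i "Suc i"] i' by auto
      have "\<exists>s. ts ! i \<le> s \<and> s \<le> ts ! Suc i \<and> f s = c"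
        using i'(2) IVT'[of f "ts!i" c "ts ! Suc i", OF _ _ le cont] IVT2'[of f "ts ! Suc i" c "ts ! i", OF _ _ le cont]
        by (auto simp: I_def min_def max_def split: if_splits)
      then obtain s where s: "ts ! i \<le> s" "s \<le> ts ! Suc i" "f s = c" by blast
      have "s \<noteq> ts ! i" "s \<noteq> ts ! Suc i" using s(3) i'(2) by (auto simp: I_def min_def max_def split: if_splits)
      with s show ?thesis by force
    qed
    then obtain s where s: "\<And>i. i \<in> J \<Longrightarrow> ts ! i < s i \<and> s i < ts ! Suc i \<and> f (s i) = c" by metis
    have lt: "s i < s j" if "i < j" "i \<in> J" "j \<in> J" for i j
      using s[of i] s[of j] mono[of "Suc i" j] that by (force simp: J_def)
    have "inj_on s J" by (rule inj_onI) (metis lt linorder_cases less_irrefl)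
    have fin: "finite J" by (simp add: J_def)
    have sum: "(\<Sum>i<?n. indicat_real (I i) c) = card J"
      by (simp add: indicator_def J_def sum.If_cases Int_def)
    show ?thesis
    proof (cases "J = {}")
      case False
      then obtain i where "i \<in> J" by auto
      then have mc: "m < c" "c < M"
        using f(2)[of "ts ! i"] f(2)[of "ts ! Suc i"] tsI[of i] by (auto simp: J_def I_def)
      have "card (s ` J) \<le> N"
        by (rule lev[OF _ _ mc]) (use fin s tsI in \<open>force simp: J_def\<close>)+
      then have "card J \<le> N" using card_image[OF \<open>inj_on s J\<close>] by simp
      then show ?thesis unfolding sum using mc by simp
    qed (unfold sum, simp)
  qed
  have int1: "((\<lambda>c. \<Sum>i<?n. indicat_real (I i) c) has_integral (\<Sum>i<?n. \<bar>f (ts ! Suc i) - f (ts ! i)\<bar>)) UNIV"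
  proof (rule has_integral_sum)
    fix i
    have "emeasure lborel (I i) = ennreal \<bar>f (ts ! Suc i) - f (ts ! i)\<bar>"
      by (simp add: I_def min_def max_def abs_if)
    then show "(indicat_real (I i) has_integral \<bar>f (ts ! Suc i) - f (ts ! i)\<bar>) UNIV"
      using has_integral_integral_lborel[of "indicat_real (I i)"]
      by (simp add: I_def measure_def integrable_indicator_iff)
  qed simp
  have int2: "((\<lambda>c. N * indicat_real {m..M} c) has_integral (N * (M - m))) UNIV"
    using has_integral_mult_right[of "indicat_real {m..M}" "M - m" UNIV "real N"]
      has_integral_integral_lborel[of "indicat_real {m..M}"] \<open>m \<le> M\<close>
    by simp
  show ?thesis by (rule has_integral_le[OF int1 int2 count])
qed

section \<open>Cauchy's formula for the length\<close>

text \<open>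
  The extreme points in a direction lie on the curve itself, so a polygon inscribed in the curve can
  come close to the full width of \<open>K\<close>.
\<close>

lemma support_attained_frontier:
  fixes K :: "'a::real_inner set"
  assumes K: "compact K" "K \<noteq> {}" and v: "v \<noteq> 0"
  obtains x where "x \<in> frontier K" "support K v = v \<bullet> x"
proof -
  obtain x where x: "x \<in> K" "support K v = v \<bullet> x" "\<And>y. y \<in> K \<Longrightarrow> v \<bullet> y \<le> v \<bullet> x"
    using support_attained[OF K] by metis
  have "x \<notin> interior K"
  proof
    assume "x \<in> interior K"
    then obtain e where e: "e > 0" "cball x e \<subseteq> K" by (auto simp: mem_interior_cball)
    have "x + (e / norm v) *\<^sub>R v \<in> cball x e" using e v by (simp add: dist_norm)
    then have "v \<bullet> (x + (e / norm v) *\<^sub>R v) \<le> v \<bullet> x" using e x(3) by blast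
    then have "(e / norm v) * (v \<bullet> v) \<le> 0" by (simp add: inner_add_right)
    moreover have "(e / norm v) * (v \<bullet> v) > 0" using e v by simp
    ultimately show False by linarith
  qed
  then have "x \<in> frontier K" using x(1) closure_subset by (auto simp: frontier_def)
  then show ?thesis using that x(2) by blast
qed

text \<open>
  A closed walk has to go from the level \<open>a k\<close> to the level \<open>a j\<close> and back again.
\<close>

lemma closed_variation_ge:
  fixes a :: "nat \<Rightarrow> real"
  assumes closed: "a n = a 0" and jk: "j \<le> n" "k \<le> n"
  shows "2 * (a j - a k) \<le> (\<Sum>i<n. \<bar>a (Suc i) - a i\<bar>)"
proof -
  define V where "V p q = (\<Sum>i=p..<q. \<bar>a (Suc i) - a i\<bar>)" for p q
  have V: "\<bar>a q - a p\<bar> \<le> V p q" if "p \<le> q" for p q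
    using sum_abs[of "\<lambda>i. a (Suc i) - a i" "{p..<q}"] sum_Suc_diff'[OF that, of a] by (simp add: V_def)
  \<comment> \<open>Cut the cycle at \<open>p\<close> and \<open>q\<close>; the second arc runs through the base point \<open>a n = a 0\<close>.\<close>
  define p q where "p = min j k" and "q = max j k"
  have pq: "p \<le> q" "q \<le> n" using jk by (auto simp: p_def q_def)
  have "(\<Sum>i<n. \<bar>a (Suc i) - a i\<bar>) = V 0 p + V p q + V q n"
    
    unfolding V_def lessThan_atLeast0 using pq by (simp add: sum.atLeastLessThan_concat)
  moreover have "\<bar>a j - a k\<bar> = \<bar>a q - a p\<bar>" by (auto simp: p_def q_def min_def max_def)
  ultimately show ?thesis using V[of 0 p] V[of p q] V[of q n] pq closed by simp
qed

text \<open>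
  In each direction the curve rises once and falls once. This is expressed without any ordering of
  the curve: every intermediate level is taken at most twice. The end points of the parameter
  interval, where a closed path repeats its value, do no harm because the counted parameters are
  interior to subintervals.
\<close>

lemma variation_inner_le_width:
  fixes K :: "(real^2) set"
  assumes K: "convex K" "compact K" "interior K \<noteq> {}"
    and g: "simple_path g" "path_image g = frontier K"
    and ts: "sorted ts" "set ts \<subseteq> {0..1}"
  shows "(\<Sum>i<length ts - 1. \<bar>u \<bullet> (g (ts ! Suc i) - g (ts ! i))\<bar>) \<le> 2 * width K u"
proof -
  have cl: "closed K" and ne: "K \<noteq> {}" using K compact_imp_closed by auto
  obtain a where a: "a \<in> K" "support K (- u) = (- u) \<bullet> a" using support_attained[OF K(2) ne] by metis
  obtain b where b: "b \<in> K" "support K u = u \<bullet> b" using support_attained[OF K(2) ne] by metis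
  have gK: "g s \<in> frontier K" "g s \<in> K" if "s \<in> {0..1}" for s
    using g(2) that frontier_subset_closed[OF cl] by (auto simp: path_image_def)
  have inj: "inj_on g {0<..<1}"
  proof (rule inj_onI)
    fix s t :: real assume "s \<in> {0<..<1}" "t \<in> {0<..<1}" "g s = g t"
    moreover from this have "s \<in> {0..1}" "t \<in> {0..1}" by auto
    ultimately have "s = t \<or> s = 0 \<and> t = 1 \<or> s = 1 \<and> t = 0"
      using g(1) unfolding simple_path_def loop_free_def by blast
    then show "s = t" using \<open>s \<in> {0<..<1}\<close> by auto
  qed
  have "(\<Sum>i<length ts - 1. \<bar>u \<bullet> g (ts ! Suc i) - u \<bullet> g (ts ! i)\<bar>) \<le> real 2 * (support K u - (- support K (- u)))"
  proof (rule variation_le_if_levels_card_le[OF _ _ _ ts])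
    show "continuous_on {0..1} (\<lambda>s. u \<bullet> g s)"
      using g(1) by (intro continuous_intros) (simp add: simple_path_def path_def)
    fix s :: real assume "s \<in> {0..1}"
    then show "- support K (- u) \<le> u \<bullet> g s \<and> u \<bullet> g s \<le> support K u"
      using inner_le_support[OF K(2) gK(2), of s "- u"] inner_le_support[OF K(2) gK(2), of s u] by simp
  next
    fix c F
    assume F: "finite F" "F \<subseteq> {0<..<1}" and c: "- support K (- u) < c" "c < support K u"
      and lev: "\<And>s. s \<in> F \<Longrightarrow> u \<bullet> g s = c"
    have "card (g ` F) \<le> 2"
      by (rule card_line_frontier_le_2[OF K(1) cl K(3) a(1) _ b(1)])
         (use a b c F lev gK(1) in \<open>auto simp: subset_iff\<close>)
    then show "card F \<le> 2" using card_image[of g F] inj_on_subset[OF inj F(2)] by simp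
  qed
  then show ?thesis by (simp add: inner_diff_right width_def)
qed

lemma polygon_length_has_integral:
  fixes g :: "real \<Rightarrow> real^2"
  shows "((\<lambda>t. \<Sum>i<n. \<bar>dir t \<bullet> (g (ts ! Suc i) - g (ts ! i))\<bar>)
            has_integral 4 * (\<Sum>i<n. dist (g (ts ! i)) (g (ts ! Suc i)))) {0..2*pi}"
  unfolding sum_distrib_left dist_norm norm_minus_commute[of "g (ts ! i)" "g (ts ! Suc i)" for i]
  by (intro has_integral_sum has_integral_abs_inner_dir) simp

lemma inscribed_polygon_length_le:
  fixes K :: "(real^2) set"
  assumes K: "convex K" "compact K" "interior K \<noteq> {}"
    and g: "simple_path g" "path_image g = frontier K"
    and ts: "sorted ts" "set ts \<subseteq> {0..1}"
  shows "(\<Sum>i<length ts - 1. dist (g (ts ! i)) (g (ts ! Suc i)))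
           \<le> integral {0..2*pi} (\<lambda>t. width K (dir t)) / 2"
proof -
  have "K \<noteq> {}" using K(3) by auto
  then have "((\<lambda>t. 2 * width K (dir t)) has_integral 2 * integral {0..2*pi} (\<lambda>t. width K (dir t))) {0..2*pi}"
    by (intro has_integral_mult_right integrable_integral integrable_continuous_real
          continuous_on_width_dir K)
  from has_integral_le[OF polygon_length_has_integral this variation_inner_le_width[OF K g ts]]
  show ?thesis by simp
qed

text \<open>
  For a fine subdivision the vertices come within \<open>d\<close> of the two extreme points in every direction
  at once, by uniform continuity, so in every direction the closed polygon has variation at least
  twice the width minus \<open>4 * d\<close>. The choice of \<open>d\<close> makes the integrated error equal to \<open>e\<close>.
\<close>

lemma inscribed_polygon_length_ge:
  fixes K :: "(real^2) set"
  assumes K: "compact K" "K \<noteq> {}"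
    and g: "path g" "pathfinish g = pathstart g" "path_image g = frontier K" and e: "e > 0"
  obtains ts where "sorted ts" "set ts \<subseteq> {0..1}"
    "integral {0..2*pi} (\<lambda>t. width K (dir t)) / 2 - e
       \<le> (\<Sum>i<length ts - 1. dist (g (ts ! i)) (g (ts ! Suc i)))"
proof -
  define d where "d = e / (2 * pi)"
  have d: "d > 0" using e by (simp add: d_def)
  have "uniformly_continuous_on {0..1} g"
    using g(1) by (intro compact_uniformly_continuous) (auto simp: path_def)
  then obtain r where r: "r > 0"
    "\<And>s t. s \<in> {0..1} \<Longrightarrow> t \<in> {0..1} \<Longrightarrow> dist t s < r \<Longrightarrow> dist (g t) (g s) < d"
    unfolding uniformly_continuous_on_def using d by metis
  obtain n where n: "n > 0" "1 / real n < r"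
    using reals_Archimedean[OF r(1)] by (metis inverse_eq_divide zero_less_Suc)
  define ts where "ts = map (\<lambda>i. real i / real n) [0..<Suc n]"
  have nth: "ts ! i = real i / real n" if "i \<le> n" for i
    using that by (simp add: ts_def nth_append del: upt_Suc)
  have len: "length ts - 1 = n" by (simp add: ts_def)
  have ts: "sorted ts" "set ts \<subseteq> {0..1}"
  proof -
    show "sorted ts"
      unfolding sorted_iff_nth_mono
    proof (intro allI impI)
      fix i j assume "i \<le> j" "j < length ts"
      then have "i \<le> n" "j \<le> n" using len by linarith+
      then show "ts ! i \<le> ts ! j" using \<open>i \<le> j\<close> by (simp add: nth divide_right_mono)
    qed
    show "set ts \<subseteq> {0..1}"
    proof
      fix x assume "x \<in> set ts"
      then obtain i where "i < Suc n" "x = real i / real n"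
        unfolding ts_def set_map set_upt by force
      then show "x \<in> {0..1}" using n(1) by simp
    qed
  qed
  have near: "\<exists>j\<le>n. u \<bullet> x - d \<le> u \<bullet> g (ts ! j)" if x: "x \<in> frontier K" and u: "norm u = 1" for x u
  proof -
    obtain s where s: "s \<in> {0..1}" "x = g s" using x unfolding g(3)[symmetric] path_image_def by blast
    define j where "j = nat \<lfloor>s * n\<rfloor>"
    have j: "real j \<le> s * n" "s * n < real j + 1" using s(1) by (auto simp: j_def)
    have "s * real n \<le> 1 * real n" using s(1) by (intro mult_right_mono) auto
    with j have jn: "j \<le> n" by linarith
    have "real j / n \<le> s" "s < real j / n + 1 / n" using j n(1) by (simp_all add: field_simps)
    then have "dist (ts ! j) s < r" using n(2) by (simp add: nth[OF jn] dist_real_def)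
    then have "dist (g (ts ! j)) (g s) < d" using r(2)[OF s(1)] nth[OF jn] jn n(1) by simp
    moreover have "u \<bullet> (x - g (ts ! j)) \<le> dist (g (ts ! j)) (g s)"
      using norm_cauchy_schwarz[of u "x - g (ts ! j)"] u s(2) by (simp add: dist_norm norm_minus_commute)
    ultimately show ?thesis using jn by (auto simp: inner_diff_right intro!: exI[of _ j])
  qed
  have var: "2 * width K u - 4 * d \<le> (\<Sum>i<length ts - 1. \<bar>u \<bullet> (g (ts ! Suc i) - g (ts ! i))\<bar>)"
    if u: "norm u = 1" for u
  proof -
    have "u \<noteq> 0" "- u \<noteq> 0" using u by auto
    then obtain x y where x: "x \<in> frontier K" "support K u = u \<bullet> x"
      and y: "y \<in> frontier K" "support K (- u) = (- u) \<bullet> y"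
      using support_attained_frontier[OF K] by metis
    obtain j where j: "j \<le> n" "u \<bullet> x - d \<le> u \<bullet> g (ts ! j)" using near[OF x(1) u] by blast
    obtain k where k: "k \<le> n" "(- u) \<bullet> y - d \<le> (- u) \<bullet> g (ts ! k)" using near[OF y(1), of "- u"] u by auto
    have "g (ts ! n) = g (ts ! 0)" using g(2) n(1) by (simp add: nth pathfinish_def pathstart_def)
    then have "2 * (u \<bullet> g (ts ! j) - u \<bullet> g (ts ! k)) \<le> (\<Sum>i<n. \<bar>u \<bullet> g (ts ! Suc i) - u \<bullet> g (ts ! i)\<bar>)"
      using closed_variation_ge[of "\<lambda>i. u \<bullet> g (ts ! i)" n j k] j k by simp
    then show ?thesis using x y j k unfolding len by (simp add: width_def inner_diff_right)
  qed
  have I: "((\<lambda>t. 2 * width K (dir t) - 4 * d) has_integral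
          (2 * integral {0..2*pi} (\<lambda>t. width K (dir t)) - 4 * d * (2 * pi))) {0..2*pi}"
    using has_integral_const_real[of "4 * d" 0 "2 * pi"]
    by (intro has_integral_diff has_integral_mult_right integrable_integral integrable_continuous_real
          continuous_on_width_dir K) (simp add: mult.commute)
  from has_integral_le[OF I polygon_length_has_integral var] have
    "2 * integral {0..2*pi} (\<lambda>t. width K (dir t)) - 4 * d * (2 * pi)
       \<le> 4 * (\<Sum>i<length ts - 1. dist (g (ts ! i)) (g (ts ! Suc i)))" by simp
  then show ?thesis using that[OF ts] by (simp add: d_def)
qed

text \<open>
  Cauchy's formula. In particular all simple closed parametrizations of the frontier have the same
  length.
\<close>

theorem path_length_eq_integral_width:
  fixes K :: "(real^2) set"
  assumes K: "convex K" "compact K" "interior K \<noteq> {}"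
    and g: "simple_path g" "pathfinish g = pathstart g" "path_image g = frontier K"
  shows "path_length g = ennreal (integral {0..2*pi} (\<lambda>t. width K (dir t)) / 2)"
    (is "_ = ennreal ?L")
proof (rule antisym)
  show "path_length g \<le> ennreal ?L"
    unfolding path_length_def
    using inscribed_polygon_length_le[OF K g(1,3)] by (auto intro!: SUP_least ennreal_leI)
next
  show "ennreal ?L \<le> path_length g"
  proof (rule ennreal_le_epsilon)
    fix e :: real assume e: "e > 0"
    have ne: "K \<noteq> {}" using K(3) by auto
    obtain ts where ts: "sorted ts" "set ts \<subseteq> {0..1}"
      "?L - e \<le> (\<Sum>i<length ts - 1. dist (g (ts ! i)) (g (ts ! Suc i)))"
      by (rule inscribed_polygon_length_ge[OF K(2) ne simple_path_imp_path[OF g(1)] g(2,3) e])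
    then have "ennreal ?L \<le> ennreal ((\<Sum>i<length ts - 1. dist (g (ts ! i)) (g (ts ! Suc i))) + e)"
      by (intro ennreal_leI) simp
    also have "\<dots> = (\<Sum>i<length ts - 1. ennreal (dist (g (ts ! i)) (g (ts ! Suc i)))) + ennreal e"
      using e by (simp add: ennreal_plus sum_nonneg)
    also have "\<dots> \<le> path_length g + ennreal e"
      unfolding path_length_def using ts by (intro add_right_mono SUP_upper) auto
    finally show "ennreal ?L \<le> path_length g + ennreal e" .
  qed
qed

text \<open>
  A compact convex set is the convex hull of its frontier, so a segment as frontier would leave no
  room for interior points.
\<close>

lemma frontier_not_segment:
  fixes K :: "'a::euclidean_space set"
  assumes K: "convex K" "compact K" "interior K \<noteq> {}" and "DIM('a) \<ge> 2"
  shows "frontier K \<noteq> closed_segment a b"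
proof
  assume "frontier K = closed_segment a b"
  then have "K = closed_segment a b"
    using Krein_Milman_frontier[OF K(1,2)] by (simp add: hull_same)
  then show False using K(3) assms(4) by (simp add: interior_closed_segment_ge2)
qed

lemma simple_path_circle:
  "simple_path (\<lambda>t. dir (2 * pi * t))" "path_image (\<lambda>t. dir (2 * pi * t)) = sphere 0 1"
proof -
  have "path (\<lambda>t. dir (2 * pi * t))" unfolding path_def by (intro continuous_intros)
  moreover have "loop_free (\<lambda>t. dir (2 * pi * t))"
    unfolding loop_free_def
  proof (intro ballI impI)
    fix x y :: real
    assume xy: "x \<in> {0..1}" "y \<in> {0..1}" and eq: "dir (2 * pi * x) = dir (2 * pi * y)"
    from arg_cong[OF eq, of "\<lambda>v. v $ 1"] arg_cong[OF eq, of "\<lambda>v. v $ 2"]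
    have "sin (2 * pi * x) = sin (2 * pi * y) \<and> cos (2 * pi * x) = cos (2 * pi * y)" by simp
    then obtain n :: int where "2 * pi * x = 2 * pi * y + 2 * pi * n"
      using sin_cos_eq_iff by blast
    then have "2 * pi * x = 2 * pi * (y + n)" by (simp add: algebra_simps)
    then have n: "x = y + of_int n" by simp
    then have "\<bar>real_of_int n\<bar> \<le> 1" using xy by auto
    then have "n = -1 \<or> n = 0 \<or> n = 1" by linarith
    then show "x = y \<or> x = 0 \<and> y = 1 \<or> x = 1 \<and> y = 0" using n xy by auto
  qed
  ultimately show "simple_path (\<lambda>t. dir (2 * pi * t))" by (simp add: simple_path_def)
  show "path_image (\<lambda>t. dir (2 * pi * t)) = sphere 0 1"
  proof
    show "sphere 0 1 \<subseteq> path_image (\<lambda>t. dir (2 * pi * t))"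
    proof
      fix v :: "real^2" assume "v \<in> sphere 0 1"
      then obtain t where "0 \<le> t" "t \<le> 2 * pi" "v = dir t" using unit_vector_eq_dir[of v] by auto
      then show "v \<in> path_image (\<lambda>t. dir (2 * pi * t))"
        unfolding path_image_def by (intro image_eqI[of _ _ "t / (2 * pi)"]) auto
    qed
  qed (auto simp: path_image_def)
qed

text \<open>
  The frontier of a planar convex body is homeomorphic to the unit circle, since all relative
  frontiers of bounded convex sets of equal dimension are homeomorphic.
\<close>

lemma frontier_simple_closed_path:
  fixes K :: "(real^2) set"
  assumes K: "convex K" "compact K" "interior K \<noteq> {}"
  obtains g where "simple_path g" "pathfinish g = pathstart g" "path_image g = frontier K"
proof -
  have "aff_dim K = aff_dim (cball 0 1 :: (real^2) set)"
    using K(3) by (simp add: aff_dim_nonempty_interior)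
  then have "rel_frontier (cball (0::real^2) 1) homeomorphic rel_frontier K"
    using homeomorphic_rel_frontiers_convex_bounded_sets[of "cball (0::real^2) 1" K] K
    by (simp add: compact_imp_bounded)
  then have "sphere (0::real^2) 1 homeomorphic frontier K"
    using K(3) by (simp add: rel_frontier_nonempty_interior)
  then obtain h h' where h: "homeomorphism (sphere (0::real^2) 1) (frontier K) h h'"
    by (auto simp: homeomorphic_def)
  let ?c = "\<lambda>t. dir (2 * pi * t)"
  show ?thesis
  proof (rule that[of "h \<circ> ?c"])
    show "simple_path (h \<circ> ?c)"
      using h simple_path_circle
      by (intro simple_path_continuous_image) (auto simp: homeomorphism_def intro: inj_on_inverseI)
    have "dir (2 * pi) = dir 0" by (simp add: vec_eq_iff dir_def)
    then show "pathfinish (h \<circ> ?c) = pathstart (h \<circ> ?c)" by (simp add: pathfinish_def pathstart_def)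
    show "path_image (h \<circ> ?c) = frontier K"
      using h simple_path_circle(2) by (simp add: path_image_compose homeomorphism_def)
  qed
qed

theorem perimeter_eq_integral_width:
  fixes K :: "(real^2) set"
  assumes K: "convex K" "compact K" "interior K \<noteq> {}"
  shows "perimeter (frontier K) = ennreal (integral {0..2*pi} (\<lambda>t. width K (dir t)) / 2)"
proof -
  have "\<nexists>a b. frontier K = closed_segment a b" using frontier_not_segment[OF K] by simp
  moreover obtain g where g: "simple_path g" "pathfinish g = pathstart g" "path_image g = frontier K"
    by (rule frontier_simple_closed_path[OF K])
  moreover have "(THE l. \<exists>g. simple_path g \<and> pathfinish g = pathstart g \<and> path_image g = frontier K \<and> l = path_length g)
      = ennreal (integral {0..2*pi} (\<lambda>t. width K (dir t)) / 2)"
    by (rule the_equality) (use path_length_eq_integral_width[OF K] g in metis)+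
  ultimately show ?thesis unfolding perimeter_def by (subst if_not_P) blast+
qed

lemma perimeter_segment: "perimeter (closed_segment a b) = ennreal (2 * dist a b)"
proof -
  have dist: "dist c d = dist a b" if "closed_segment a b = closed_segment c d" for c d
    using that by (auto simp: closed_segment_eq doubleton_eq_iff dist_commute)
  have "(THE l. \<exists>c d. closed_segment a b = closed_segment c d \<and> l = ennreal (2 * dist c d)) = ennreal (2 * dist a b)"
  proof (rule the_equality)
    fix l assume "\<exists>c d. closed_segment a b = closed_segment c d \<and> l = ennreal (2 * dist c d)"
    then show "l = ennreal (2 * dist a b)" using dist by metis
  qed blast
  then show ?thesis unfolding perimeter_def by (subst if_P) blast+
qed

section \<open>Half-disks\<close>

text \<open>
  The half-disks in invariant form: \<open>p\<close> is the centre and \<open>u\<close> the inner unit normal of the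
  diameter. For a unit vector \<open>u\<close> and \<open>r > 0\<close> these are exactly the isometric copies of \<open>HD r\<close>,
  as the lemmas \<open>half_disk_imp_half_disk_at\<close> and \<open>half_disk_half_disk_at\<close> show.
\<close>

definition half_disk_at :: "real^2 \<Rightarrow> real^2 \<Rightarrow> real \<Rightarrow> (real^2) set" where
  "half_disk_at p u r = {x. 0 \<le> u \<bullet> (x - p) \<and> norm (x - p) \<le> r}"

text \<open>
  With \<open>u\<close> and \<open>e\<close> as the rows of a \<open>2\<times>2\<close> matrix, the hypotheses say that its rows are orthonormal;
  the expansion says that its columns are orthonormal too.
\<close>

lemma orthonormal_pair_expansion:
  fixes u e w :: "real^2"
  assumes "norm u = 1" "norm e = 1" "u \<bullet> e = 0"
  shows "w = (u \<bullet> w) *\<^sub>R u + (e \<bullet> w) *\<^sub>R e"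
proof -
  have h: "u$1 * u$1 + u$2 * u$2 = 1" "e$1 * e$1 + e$2 * e$2 = 1" "u$1 * e$1 + u$2 * e$2 = 0"
    using assms norm_real2[of u] norm_real2[of e] by (simp_all add: inner_real2 power2_eq_square)
  have "u$1 * u$1 + e$1 * e$1 = 1" "u$2 * u$2 + e$2 * e$2 = 1" "u$1 * u$2 + e$1 * e$2 = 0"
    using h by algebra+
  then have "w$1 = (u$1 * w$1 + u$2 * w$2) * u$1 + (e$1 * w$1 + e$2 * w$2) * e$1"
    "w$2 = (u$1 * w$1 + u$2 * w$2) * u$2 + (e$1 * w$1 + e$2 * w$2) * e$2"
    by algebra+
  then show ?thesis by (simp add: vec_eq_iff forall_2 inner_real2)
qed

lemma orthonormal_pair_inner:
  fixes u e w :: "real^2"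
  assumes "norm u = 1" "norm e = 1" "u \<bullet> e = 0"
  shows "v \<bullet> w = (u \<bullet> v) * (u \<bullet> w) + (e \<bullet> v) * (e \<bullet> w)"
  by (subst orthonormal_pair_expansion[OF assms, of w])
     (simp add: inner_add_right inner_commute mult.commute)

lemma orthonormal_pair_norm:
  fixes u e w :: "real^2"
  assumes "norm u = 1" "norm e = 1" "u \<bullet> e = 0"
  shows "(norm w)\<^sup>2 = (u \<bullet> w)\<^sup>2 + (e \<bullet> w)\<^sup>2"
  unfolding power2_norm_eq_inner using orthonormal_pair_inner[OF assms, of w w] by (simp add: power2_eq_square)

lemma obtain_orthonormal:
  fixes u :: "real^2"
  assumes "norm u = 1"
  obtains e where "norm e = 1" "u \<bullet> e = 0"
proof -
  define e :: "real^2" where "e = (\<chi> i. if i = 1 then - u$2 else u$1)"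
  have "(norm e)\<^sup>2 = (norm u)\<^sup>2" by (simp add: norm_real2 e_def)
  then have "norm e = 1" using assms power2_eq_iff_nonneg[of "norm e" "norm u"] by simp
  moreover have "u \<bullet> e = 0" by (simp add: inner_real2 e_def)
  ultimately show ?thesis by (rule that)
qed

lemma convex_half_disk_at: "convex (half_disk_at p u r)"
proof -
  have "half_disk_at p u r = {x. u \<bullet> p \<le> u \<bullet> x} \<inter> cball p r"
    by (auto simp: half_disk_at_def dist_norm norm_minus_commute inner_diff_right)
  then show ?thesis by (simp add: convex_Int convex_halfspace_ge)
qed

lemma compact_half_disk_at: "compact (half_disk_at p u r)"
proof -
  have "half_disk_at p u r = {x. u \<bullet> p \<le> u \<bullet> x} \<inter> cball p r"
    by (auto simp: half_disk_at_def dist_norm norm_minus_commute inner_diff_right)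
  then show ?thesis by (simp add: closed_Int_compact closed_halfspace_ge)
qed

lemma interior_half_disk_at:
  assumes "norm u = 1" "r > 0"
  shows "interior (half_disk_at p u r) \<noteq> {}"
proof -
  let ?U = "{x. u \<bullet> p < u \<bullet> x} \<inter> ball p r"
  have "p + (r/2) *\<^sub>R u \<in> ?U"
    using assms by (simp add: inner_add_right dist_norm dot_square_norm)
  moreover have "?U \<subseteq> interior (half_disk_at p u r)"
    by (rule interior_maximal)
       (auto simp: half_disk_at_def dist_norm norm_minus_commute inner_diff_right open_halfspace_gt)
  ultimately show ?thesis by blast
qed

text \<open>
  In a direction pointing to the side of the arc the extreme point lies on the arc; otherwise it is
  one of the two end points \<open>p \<plusminus> r e\<close> of the diameter.
\<close>

lemma support_half_disk_at:
  assumes on: "norm u = 1" "norm e = 1" "u \<bullet> e = 0" and w: "norm w = 1" and r: "r \<ge> 0"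
  shows "support (half_disk_at p u r) w = w \<bullet> p + (if u \<bullet> w \<ge> 0 then r else r * \<bar>e \<bullet> w\<bar>)"
proof (cases "u \<bullet> w \<ge> 0")
  case True
  have "support (half_disk_at p u r) w = w \<bullet> p + r"
    unfolding support_def
  proof (rule cSup_eq_maximum)
    show "w \<bullet> p + r \<in> (\<bullet>) w ` half_disk_at p u r"
      by (rule image_eqI[of _ _ "p + r *\<^sub>R w"])
         (use True r w in \<open>auto simp: half_disk_at_def inner_add_right dot_square_norm\<close>)
  next
    fix y assume "y \<in> (\<bullet>) w ` half_disk_at p u r"
    then obtain x where x: "y = w \<bullet> x" "norm (x - p) \<le> r" by (auto simp: half_disk_at_def)
    have "w \<bullet> (x - p) \<le> r" using norm_cauchy_schwarz[of w "x - p"] w x(2) by simp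
    then show "y \<le> w \<bullet> p + r" by (simp add: x inner_diff_right)
  qed
  then show ?thesis using True by simp
next
  case False
  have "support (half_disk_at p u r) w = w \<bullet> p + r * \<bar>e \<bullet> w\<bar>"
    unfolding support_def
  proof (rule cSup_eq_maximum)
    let ?x = "p + (r * sgn (e \<bullet> w)) *\<^sub>R e"
    have "norm (?x - p) = r * \<bar>sgn (e \<bullet> w)\<bar>" using on r by (simp add: abs_mult)
    also have "\<dots> \<le> r" using r by (simp add: abs_sgn_eq)
    finally have "?x \<in> half_disk_at p u r" using on by (simp add: half_disk_at_def)
    moreover have "w \<bullet> ?x = w \<bullet> p + r * \<bar>e \<bullet> w\<bar>"
      by (simp add: inner_add_right inner_commute[of w e] abs_sgn mult.commute)
    ultimately show "w \<bullet> p + r * \<bar>e \<bullet> w\<bar> \<in> (\<bullet>) w ` half_disk_at p u r"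
      by (metis imageI)
  next
    fix y assume "y \<in> (\<bullet>) w ` half_disk_at p u r"
    then obtain x where x: "y = w \<bullet> x" "norm (x - p) \<le> r" "0 \<le> u \<bullet> (x - p)"
      by (auto simp: half_disk_at_def)
    have "\<bar>e \<bullet> (x - p)\<bar> \<le> r" using Cauchy_Schwarz_ineq2[of e "x - p"] on x(2) by simp
    then have "\<bar>e \<bullet> w\<bar> * \<bar>e \<bullet> (x - p)\<bar> \<le> \<bar>e \<bullet> w\<bar> * r" by (rule mult_left_mono) simp
    then have "(e \<bullet> w) * (e \<bullet> (x - p)) \<le> \<bar>e \<bullet> w\<bar> * r"
      using abs_ge_self[of "(e \<bullet> w) * (e \<bullet> (x - p))"] unfolding abs_mult by linarith
    moreover have "(u \<bullet> w) * (u \<bullet> (x - p)) \<le> 0" using False x(3) by (simp add: mult_nonpos_nonneg)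
    ultimately have "w \<bullet> (x - p) \<le> r * \<bar>e \<bullet> w\<bar>"
      using orthonormal_pair_inner[OF on, of w "x - p"] by (simp add: mult.commute)
    then show "y \<le> w \<bullet> p + r * \<bar>e \<bullet> w\<bar>" by (simp add: x inner_diff_right)
  qed
  then show ?thesis using False by simp
qed

text \<open>
  Of two opposite directions one points to the side of the arc and contributes \<open>r\<close>, and the other
  contributes half the shadow of the diameter. So the width has no case distinction, and its integral
  reduces to \<open>has_integral_abs_inner_dir\<close>.
\<close>

lemma width_half_disk_at:
  assumes on: "norm u = 1" "norm e = 1" "u \<bullet> e = 0" and w: "norm w = 1" and r: "r \<ge> 0"
  shows "width (half_disk_at p u r) w = r + r * \<bar>w \<bullet> e\<bar>"
proof (cases "u \<bullet> w = 0")
  case True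
  then have "\<bar>e \<bullet> w\<bar> = 1" using orthonormal_pair_norm[OF on, of w] w by (auto simp: power2_eq_1_iff)
  with True show ?thesis
    using support_half_disk_at[OF on w r] support_half_disk_at[OF on _ r, of "- w"] w
    by (simp add: width_def inner_commute)
next
  case False
  then show ?thesis
    using support_half_disk_at[OF on w r] support_half_disk_at[OF on _ r, of "- w"] w
    by (auto simp: width_def inner_commute)
qed

lemma integral_width_half_disk_at:
  assumes u: "norm u = 1" and r: "r \<ge> 0"
  shows "integral {0..2*pi} (\<lambda>t. width (half_disk_at p u r) (dir t)) / 2 = (2 + pi) * r"
proof -
  obtain e where e: "norm e = 1" "u \<bullet> e = 0" by (rule obtain_orthonormal[OF u])
  have "((\<lambda>t. r + r * \<bar>dir t \<bullet> e\<bar>) has_integral (2 * pi * r + r * (4 * norm e))) {0..2*pi}"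
    using has_integral_const_real[of r 0 "2 * pi"]
    by (intro has_integral_add has_integral_mult_right has_integral_abs_inner_dir) simp
  then show ?thesis
    using e by (simp add: width_half_disk_at[OF u e norm_dir r] integral_unique algebra_simps)
qed

lemma HD_eq_half_disk_at:
  assumes "r \<ge> 0"
  shows "HD r = half_disk_at 0 (axis 2 1) r"
proof -
  have "norm x \<le> r \<longleftrightarrow> (x$1)\<^sup>2 + (x$2)\<^sup>2 \<le> r\<^sup>2" for x :: "real^2"
    using assms by (simp flip: norm_real2)
  then show ?thesis by (auto simp: HD_def half_disk_at_def inner_axis')
qed

text \<open>
  An isometry that is defined only on \<open>HD r\<close> still preserves inner products once the image of the
  centre is taken as origin. The images \<open>e\<close> and \<open>u\<close> of the two coordinate vectors, scaled into
  \<open>HD r\<close> and back, are therefore an orthonormal pair, and the isometry is the change of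
  coordinates to it.
\<close>

lemma half_disk_imp_half_disk_at:
  assumes "half_disk H"
  obtains p u r where "r > 0" "norm u = 1" "H = half_disk_at p u r"
proof -
  obtain r f where r: "r > 0" and f: "f ` HD r = H"
    "\<And>x y. x \<in> HD r \<Longrightarrow> y \<in> HD r \<Longrightarrow> dist (f x) (f y) = dist x y"
    using assms unfolding half_disk_def isometric_sets_def by auto
  define p where "p = f 0"
  define F where "F x = f x - p" for x
  have 0: "0 \<in> HD r" using r by (simp add: HD_def)
  have normF: "norm (F x) = norm x" if "x \<in> HD r" for x
    using f(2)[OF that 0] by (simp add: F_def p_def dist_norm)
  have innerF: "F x \<bullet> F y = x \<bullet> y" if "x \<in> HD r" "y \<in> HD r" for x y
  proof -
    have "norm (F x - F y) = norm (x - y)" using f(2)[OF that] by (simp add: F_def dist_norm)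
    then show ?thesis using normF[OF that(1)] normF[OF that(2)] by (simp add: dot_norm_neg)
  qed
  have ax: "r *\<^sub>R axis 1 1 \<in> HD r" "r *\<^sub>R axis 2 1 \<in> HD r"
    using r by (auto simp: HD_def axis_def)
  define e u where "e = F (r *\<^sub>R axis 1 1) /\<^sub>R r" and "u = F (r *\<^sub>R axis 2 1) /\<^sub>R r"
  have on: "norm u = 1" "norm e = 1" "u \<bullet> e = 0"
    using r normF[OF ax(1)] normF[OF ax(2)] innerF[OF ax(2) ax(1)]
    by (auto simp: e_def u_def inner_axis_axis)
  have coord: "e \<bullet> F x = x $ 1" "u \<bullet> F x = x $ 2" if "x \<in> HD r" for x
    using innerF[OF ax(1) that] innerF[OF ax(2) that] r by (simp_all add: e_def u_def inner_axis')
  have "H = half_disk_at p u r"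
  proof (intro equalityI subsetI)
    fix y assume "y \<in> H"
    then obtain x where x: "x \<in> HD r" "y = f x" using f(1) by auto
    then have "norm x \<le> r" "x $ 2 \<ge> 0"
      using HD_eq_half_disk_at[of r] r by (auto simp: half_disk_at_def HD_def)
    then show "y \<in> half_disk_at p u r"
      using normF[OF x(1)] coord(2)[OF x(1)] x(2) by (simp add: half_disk_at_def F_def)
  next
    fix y assume y: "y \<in> half_disk_at p u r"
    define x :: "real^2" where "x = (\<chi> i. if i = 1 then e \<bullet> (y - p) else u \<bullet> (y - p))"
    have xc: "x $ 1 = e \<bullet> (y - p)" "x $ 2 = u \<bullet> (y - p)" by (simp_all add: x_def)
    have "(norm (y - p))\<^sup>2 \<le> r\<^sup>2" using y by (simp add: half_disk_at_def power_mono)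
    then have x: "x \<in> HD r"
      using y orthonormal_pair_norm[OF on, of "y - p"] by (simp add: HD_def half_disk_at_def xc)
    have "F x = y - p"
      using orthonormal_pair_expansion[OF on, of "F x"] orthonormal_pair_expansion[OF on, of "y - p"]
      by (simp add: coord[OF x] xc)
    then show "y \<in> H" using f(1) x by (auto simp: F_def)
  qed
  with r on show ?thesis using that by blast
qed

lemma half_disk_half_disk_at:
  assumes r: "r > 0" and u: "norm u = 1"
  shows "half_disk (half_disk_at p u r)"
proof -
  obtain e where e: "norm e = 1" "u \<bullet> e = 0" by (rule obtain_orthonormal[OF u])
  note on = u e
  define f where "f x = p + ((x $ 1) *\<^sub>R e + (x $ 2) *\<^sub>R u)" for x :: "real^2"
  have uu: "u \<bullet> u = 1" "e \<bullet> e = 1" "e \<bullet> u = 0" using on by (auto simp: norm_eq_1 inner_commute)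
  have norm_lin: "(norm (a *\<^sub>R e + b *\<^sub>R u))\<^sup>2 = a\<^sup>2 + b\<^sup>2" for a b
    using orthonormal_pair_norm[OF on, of "a *\<^sub>R e + b *\<^sub>R u"] e(2)
    by (simp add: inner_add_right uu)
  have "dist (f x) (f y) = dist x y" for x y
  proof -
    have "f x - f y = (x$1 - y$1) *\<^sub>R e + (x$2 - y$2) *\<^sub>R u"
      by (simp add: f_def algebra_simps)
    then have "(norm (f x - f y))\<^sup>2 = (norm (x - y))\<^sup>2"
      unfolding norm_real2[of "x - y"] by (simp add: norm_lin)
    then show ?thesis by (simp add: dist_norm)
  qed
  moreover have "f ` HD r = half_disk_at p u r"
  proof (intro equalityI subsetI)
    fix y assume "y \<in> f ` HD r"
    then obtain x where x: "x \<in> HD r" "y = f x" by auto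
    then have "(norm (y - p))\<^sup>2 \<le> r\<^sup>2" by (simp add: f_def norm_lin HD_def)
    then have "norm (y - p) \<le> r" using r by (simp add: power2_le_iff_abs_le)
    moreover have "u \<bullet> (y - p) = x $ 2" using x e by (simp add: f_def inner_add_right uu)
    ultimately show "y \<in> half_disk_at p u r" using x by (simp add: half_disk_at_def HD_def)
  next
    fix y assume y: "y \<in> half_disk_at p u r"
    define x :: "real^2" where "x = (\<chi> i. if i = 1 then e \<bullet> (y - p) else u \<bullet> (y - p))"
    have xc: "x $ 1 = e \<bullet> (y - p)" "x $ 2 = u \<bullet> (y - p)" by (simp_all add: x_def)
    have "(norm (y - p))\<^sup>2 \<le> r\<^sup>2" using y by (simp add: half_disk_at_def power_mono)
    then have x: "x \<in> HD r"
      using y orthonormal_pair_norm[OF on, of "y - p"] by (simp add: HD_def half_disk_at_def xc)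
    have "f x = y"
      using orthonormal_pair_expansion[OF on, of "y - p"] by (simp add: f_def xc add.commute)
    then show "y \<in> f ` HD r" using x by auto
  qed
  ultimately show ?thesis unfolding half_disk_def isometric_sets_def using r by blast
qed

section \<open>The relative Chebyshev radius\<close>

text \<open>
  The distance to the farthest point of \<open>S\<close> is a 1-Lipschitz function, so it has a minimum on \<open>S\<close>.
\<close>

lemma rel_chebyshev_radius_attained:
  fixes S :: "'a::metric_space set"
  assumes S: "compact S" "S \<noteq> {}"
  obtains p where "p \<in> S" "\<And>q. q \<in> S \<Longrightarrow> dist p q \<le> rel_chebyshev_radius S"
proof -
  define R where "R p = (SUP q\<in>S. dist p q)" for p
  have bdd: "bdd_above (dist p ` S)" for p
    using compact_imp_bounded[OF S(1)] unfolding bounded_any_center[where a = p] by (auto simp: bdd_above_def)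
  have R: "dist p q \<le> R p" if "q \<in> S" for p q
    unfolding R_def by (rule cSUP_upper[OF that bdd])
  have le: "R p \<le> R p' + dist p p'" for p p'
    unfolding R_def[of p]
  proof (rule cSUP_least[OF S(2)])
    fix q assume "q \<in> S"
    then show "dist p q \<le> R p' + dist p p'" using R[of q p'] dist_triangle[of p q p'] by linarith
  qed
  have "1-lipschitz_on S R"
  proof (rule lipschitz_onI)
    fix x y
    show "dist (R x) (R y) \<le> 1 * dist x y"
      using le[of x y] le[of y x] by (auto simp: dist_real_def dist_commute)
  qed simp
  then obtain p where p: "p \<in> S" "\<And>p'. p' \<in> S \<Longrightarrow> R p \<le> R p'"
    using continuous_attains_inf[OF S lipschitz_on_continuous_on] by metis
  have "rel_chebyshev_radius S = R p"
    unfolding rel_chebyshev_radius_def R_def[symmetric] by (rule cInf_eq_minimum) (use p in auto)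
  then show ?thesis using that[OF p(1)] R by simp
qed

lemma rel_chebyshev_radius_le:
  fixes S :: "'a::metric_space set"
  assumes p: "p \<in> S" "\<And>q. q \<in> S \<Longrightarrow> dist p q \<le> r"
  shows "rel_chebyshev_radius S \<le> r"
proof -
  have "(SUP q\<in>S. dist p' q) \<ge> 0" if "p' \<in> S" for p'
  proof -
    have "dist p' q \<le> dist p' p + r" if "q \<in> S" for q
      using p(2)[OF that] dist_triangle[of p' q p] by linarith
    then have "bdd_above (dist p' ` S)" by (intro bdd_aboveI2)
    from cSUP_upper[OF that this] show ?thesis by simp
  qed
  then have "bdd_below ((\<lambda>p. SUP q\<in>S. dist p q) ` S)" by (intro bdd_belowI2)
  then have "rel_chebyshev_radius S \<le> (SUP q\<in>S. dist p q)"
    unfolding rel_chebyshev_radius_def using p(1) by (rule cINF_lower)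
  also have "\<dots> \<le> r" using p by (intro cSUP_least) auto
  finally show ?thesis .
qed

text \<open>
  Take a point \<open>p\<close> of the curve where the relative Chebyshev radius is attained: the curve, and with
  it its convex hull \<open>K\<close>, lies in the disk about \<open>p\<close> with that radius, and a supporting line at
  \<open>p\<close> cuts this disk down to a half-disk.
\<close>

lemma subset_half_disk_at:
  fixes K :: "(real^2) set"
  assumes K: "convex K" "compact K" "interior K \<noteq> {}"
  obtains p u where "norm u = 1" "K \<subseteq> half_disk_at p u (rel_chebyshev_radius (frontier K))"
proof -
  have "K \<noteq> UNIV" "K \<noteq> {}" using K not_compact_UNIV by auto
  then have "frontier K \<noteq> {}" by (rule frontier_not_empty[rotated])
  then obtain p where p: "p \<in> frontier K"
    "\<And>q. q \<in> frontier K \<Longrightarrow> dist p q \<le> rel_chebyshev_radius (frontier K)"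
    by (rule rel_chebyshev_radius_attained[OF compact_frontier[OF K(2)]]) blast
  obtain u where u: "norm u = 1" "\<And>k. k \<in> K \<Longrightarrow> u \<bullet> p \<le> u \<bullet> k"
    using supporting_hyperplane_frontier[OF K(1) compact_imp_closed[OF K(2)] K(3) p(1)] by metis
  have "convex hull (frontier K) \<subseteq> cball p (rel_chebyshev_radius (frontier K))"
    using p(2) by (intro hull_minimal) auto
  then have "K \<subseteq> cball p (rel_chebyshev_radius (frontier K))"
    using Krein_Milman_frontier[OF K(1,2)] by simp
  then have "K \<subseteq> half_disk_at p u (rel_chebyshev_radius (frontier K))"
    using u(2) by (auto simp: half_disk_at_def inner_diff_right dist_norm norm_minus_commute)
  with u(1) show ?thesis by (rule that)
qed

section \<open>The perimeter bound and its extremal curves\<close>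

lemma perimeter_frontier:
  fixes K :: "(real^2) set"
  assumes K: "convex K" "compact K" "interior K \<noteq> {}"
  defines "\<delta> \<equiv> rel_chebyshev_radius (frontier K)"
  shows "perimeter (frontier K) \<le> ennreal ((2 + pi) * \<delta>)"
    and "0 < \<delta>"
    and "perimeter (frontier K) = ennreal ((2 + pi) * \<delta>) \<Longrightarrow> half_disk K"
proof -
  obtain p u where u: "norm u = 1" and sub: "K \<subseteq> half_disk_at p u \<delta>"
    unfolding \<delta>_def by (rule subset_half_disk_at[OF K]) blast
  have ne: "K \<noteq> {}" using K(3) by auto
  show pos: "0 < \<delta>"
  proof (rule ccontr)
    assume "\<not> 0 < \<delta>"
    then have "half_disk_at p u \<delta> \<subseteq> {p}"
      unfolding half_disk_at_def using order_trans[of "norm (_ - p)" \<delta> 0] by auto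
    then have "interior K \<subseteq> interior {p}" using sub by (intro interior_mono) blast
    then show False using K(3) by simp
  qed
  let ?I = "\<lambda>S. integral {0..2*pi} (\<lambda>t. width S (dir t))"
  have HD: "?I (half_disk_at p u \<delta>) / 2 = (2 + pi) * \<delta>"
    using integral_width_half_disk_at[OF u] pos by simp
  have strict: "?I K < ?I (half_disk_at p u \<delta>)" if "K \<noteq> half_disk_at p u \<delta>"
    by (rule integral_width_strict_mono[OF K(2) ne K(1) compact_half_disk_at]) (use sub that in blast)
  then have le: "?I K \<le> ?I (half_disk_at p u \<delta>)" by (cases "K = half_disk_at p u \<delta>") auto
  show "perimeter (frontier K) \<le> ennreal ((2 + pi) * \<delta>)"
    unfolding perimeter_eq_integral_width[OF K] using le HD by (intro ennreal_leI) linarith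
  assume "perimeter (frontier K) = ennreal ((2 + pi) * \<delta>)"
  then have "ennreal (?I K / 2) = ennreal (?I (half_disk_at p u \<delta>) / 2)"
    unfolding HD perimeter_eq_integral_width[OF K] .
  moreover have "?I (half_disk_at p u \<delta>) / 2 > 0" unfolding HD using pos pi_gt_zero by (simp add: add_pos_pos)
  ultimately have "?I K = ?I (half_disk_at p u \<delta>)"
    using strict ennreal_less_iff[of "?I K / 2"] ennreal_lessI by (metis divide_strict_right_mono less_irrefl zero_less_numeral)
  then have "K = half_disk_at p u \<delta>" using strict by force
  then show "half_disk K" using half_disk_half_disk_at[OF pos u] by simp
qed

text \<open>
  The centre of the diameter lies on the frontier, so the relative Chebyshev radius is at most the radius \<open>r\<close>
  of \<open>H\<close>.
  That it is no smaller is the general inequality for \<open>H\<close> itself, whose perimeter is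
  \<open>(2 + pi) * r\<close>.
\<close>

lemma perimeter_frontier_half_disk:
  assumes "half_disk H"
  shows "perimeter (frontier H) = ennreal ((2 + pi) * rel_chebyshev_radius (frontier H))"
proof -
  obtain p u r where r: "r > 0" and u: "norm u = 1" and H: "H = half_disk_at p u r"
    by (rule half_disk_imp_half_disk_at[OF assms])
  have K: "convex H" "compact H" "interior H \<noteq> {}"
    unfolding H by (rule convex_half_disk_at compact_half_disk_at interior_half_disk_at[OF u r])+
  have per: "perimeter (frontier H) = ennreal ((2 + pi) * r)"
    unfolding perimeter_eq_integral_width[OF K] unfolding H using integral_width_half_disk_at[OF u] r by simp
  have "p \<in> H" using r by (simp add: H half_disk_at_def)
  moreover have "p \<notin> interior H"
  proof
    assume "p \<in> interior H"
    then obtain e where e: "e > 0" "cball p e \<subseteq> H" by (auto simp: mem_interior_cball)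
    have "p - e *\<^sub>R u \<in> cball p e" using e u by (simp add: dist_norm)
    then have "p - e *\<^sub>R u \<in> half_disk_at p u r" using e H by blast
    then have "0 \<le> u \<bullet> (- (e *\<^sub>R u))" by (simp add: half_disk_at_def)
    then show False using e u by (simp add: dot_square_norm)
  qed
  ultimately have p: "p \<in> frontier H" using closure_subset by (auto simp: frontier_def)
  have "rel_chebyshev_radius (frontier H) \<le> r"
  proof (rule rel_chebyshev_radius_le[OF p])
    fix q assume "q \<in> frontier H"
    then have "q \<in> H" using frontier_subset_closed[OF compact_imp_closed[OF K(2)]] by auto
    then show "dist p q \<le> r" by (simp add: H half_disk_at_def dist_norm norm_minus_commute)
  qed
  moreover have "(2 + pi) * r \<le> (2 + pi) * rel_chebyshev_radius (frontier H)"
    using perimeter_frontier(1)[OF K] perimeter_frontier(2)[OF K] by (simp add: per ennreal_le_iff add_nonneg_nonneg)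
  then have "r \<le> rel_chebyshev_radius (frontier H)"
    by (rule mult_left_le_imp_le) (simp add: add_pos_pos)
  ultimately show ?thesis by (simp add: per)
qed

text \<open>
  Any point of the segment has distance at least half the length from one of the end points, so the
  perimeter is at most \<open>4 * \<delta>\<close>, and \<open>4 < 2 + pi\<close>.
\<close>

lemma perimeter_segment_bound:
  fixes a b :: "real^2"
  defines "\<delta> \<equiv> rel_chebyshev_radius (closed_segment a b)"
  shows "perimeter (closed_segment a b) \<le> ennreal ((2 + pi) * \<delta>)"
    and "a \<noteq> b \<Longrightarrow> perimeter (closed_segment a b) < ennreal ((2 + pi) * \<delta>)"
proof -
  obtain p where p: "\<And>q. q \<in> closed_segment a b \<Longrightarrow> dist p q \<le> \<delta>"
    unfolding \<delta>_def by (rule rel_chebyshev_radius_attained[of "closed_segment a b"]) auto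
  have "dist a b \<le> dist p a + dist p b" by (metis dist_commute dist_triangle)
  then have d: "dist a b \<le> 2 * \<delta>" using p[of a] p[of b] by simp
  then have "0 \<le> \<delta>" using zero_le_dist[of a b] by linarith
  then have "2 * \<delta> \<le> pi * \<delta>" using pi_ge_two by (rule mult_right_mono[rotated])
  then have le: "2 * dist a b \<le> (2 + pi) * \<delta>" using d by (simp add: algebra_simps)
  then show "perimeter (closed_segment a b) \<le> ennreal ((2 + pi) * \<delta>)"
    unfolding perimeter_segment by (rule ennreal_leI)
  assume "a \<noteq> b"
  then have "0 < \<delta>" using d zero_less_dist_iff[of a b] by linarith
  then have "2 * \<delta> < pi * \<delta>" using pi_gt3 by simp
  then have "2 * dist a b < (2 + pi) * \<delta>" using d by (simp add: algebra_simps)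
  then show "perimeter (closed_segment a b) < ennreal ((2 + pi) * \<delta>)"
    unfolding perimeter_segment by (simp add: ennreal_less_iff)
qed

lemma flat_convex_set_is_segment:
  fixes K :: "(real^2) set"
  assumes "convex K" "compact K" "K \<noteq> {}" "interior K = {}"
  obtains a b where "K = closed_segment a b" "frontier K = closed_segment a b"
proof -
  obtain v c where v: "v \<noteq> 0" "K \<subseteq> {x. v \<bullet> x = c}"
    by (rule empty_interior_subset_hyperplane[OF assms(1,4)])
  then have "aff_dim K \<le> 1" using aff_dim_subset[OF v(2)] aff_dim_hyperplane[OF v(1), of c] by simp
  then have "collinear K" by (simp add: collinear_aff_dim)
  then obtain a b where "K = closed_segment a b"
    using compact_convex_collinear_segment[OF assms(3,2,1)] by metis
  moreover have "frontier K = K"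
    using assms by (simp add: frontier_def compact_imp_closed)
  ultimately show ?thesis using that by simp
qed

theorem theorem3:
  fixes \<Gamma> :: "(real^2) set"
  assumes "convex_curve \<Gamma>"
  shows "perimeter \<Gamma> \<le> ennreal ((2 + pi) * rel_chebyshev_radius \<Gamma>) \<and>
         ((\<nexists>p. \<Gamma> = {p}) \<longrightarrow>
            (perimeter \<Gamma> = ennreal ((2 + pi) * rel_chebyshev_radius \<Gamma>) \<longleftrightarrow>
             (\<exists>H. half_disk H \<and> \<Gamma> = frontier H)))"
proof -
  obtain K where K: "convex K" "compact K" "K \<noteq> {}" "\<Gamma> = frontier K"
    using assms by (auto simp: convex_curve_def)
  have "perimeter \<Gamma> \<le> ennreal ((2 + pi) * rel_chebyshev_radius \<Gamma>) \<and>
      ((\<nexists>p. \<Gamma> = {p}) \<longrightarrow> perimeter \<Gamma> = ennreal ((2 + pi) * rel_chebyshev_radius \<Gamma>) \<longrightarrow>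
         half_disk K)"
  proof (cases "interior K = {}")
    case True
    then obtain a b where seg: "\<Gamma> = closed_segment a b"
      using flat_convex_set_is_segment[OF K(1-3)] K(4) by metis
    have "a \<noteq> b" if "\<nexists>p. \<Gamma> = {p}" using that seg by auto
    then show ?thesis using perimeter_segment_bound[of a b] by (auto simp: seg)
  next
    case False
    then show ?thesis using perimeter_frontier[OF K(1,2)] K(4) by auto
  qed
  then show ?thesis using perimeter_frontier_half_disk K(4) by blast
qed

end
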